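(* Let $\mathcal K\subset\mathbb R^2$ be the Sierpinski gasket with its standard maps $l_1,l_2,l_3$, boundary $V_0=\{q_1,q_2,q_3\}$ and standard harmonic structure. Let $\mathcal J\subset\mathbb R$ be compact, let $u:V_1\to\mathbb R$ have values in $\mathcal J$, and for $n=1,2,3$ let $h_n:\mathcal K\to\mathbb R$ be a nonconstant harmonic function and $s_n:\mathcal J\to\mathcal J$ an Edelstein contraction such that $h_n(x)+s_n(y)\in\mathcal J$ for all $(x,y)\in\mathcal K\times\mathcal J$ and $h_n(q_k)+s_n(u(q_k))=u(l_n(q_k))$ for $n,k\in\{1,2,3\}$. Let $f^*:\mathcal K\to\mathcal J$ be the unique continuous function with $f^*|_{V_1}=u$ and $$f^*(l_n(x))=s_n(f^*(x))+h_n(x)\qquad (x\in\mathcal K,\ n=1,2,3),$$ and let $G=\{(x,f^*(x)):x\in\mathcal K\}\subset\mathbb R^3$ be its graph. Assume that the interpolation points $(t,u(t))$, $t\in V_1$, are not coplanar. Put $\mu=\sum_{n=1}^3L(s_n)$. Then the box-counting dimension of $G$ has the following upper bounds: (i) if $\mu>9/5$, then $\dim_B(G)\le 1+\dfrac{\log\mu}{\log2}$; (ii) if $\mu\le 9/5$, then $\dim_B(G)\le\dfrac{\log(18/5)}{\log2}\approx1.848$.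
   Context: Sierpinski gasket: $q_1=(0,0)$, $q_2=(1,0)$, $q_3=(\tfrac12,\tfrac{\sqrt3}2)$, $l_n(x)=\tfrac12(x-q_n)+q_n$; $\mathcal K$ is the unique nonempty compact set with $\mathcal K=\bigcup_{n=1}^3l_n(\mathcal K)$. $V_0=\{q_1,q_2,q_3\}$ and $V_m=\bigcup_{w\in\{1,2,3\}^m}l_w(V_0)$, where $l_w=l_{w_1}\circ\cdots\circ l_{w_m}$. Graph energies: $\mathcal E_m(v)=(5/3)^m\sum_{x\sim_my}(v(x)-v(y))^2$, where $x\sim_my$ iff $x\neq y$ and $x,y\in l_w(V_0)$ for some $w\in\{1,2,3\}^m$ (each unordered pair counted once). A harmonic function is a continuous $h:\mathcal K\to\mathbb R$ such that for each $m\ge1$, $h|_{V_m}$ minimizes $\mathcal E_m$ among functions on $V_m$ with the same values on $V_0$. An Edelstein contraction on $\mathcal J$ is a map $s:\mathcal J\to\mathcal J$ with $|s(y)-s(y')|<|y-y'|$ whenever $y\ne y'$. $L(s)=\sup_{y\ne y'\in\mathcal J}\frac{|s(y)-s(y')|}{|y-y'|}$. For a nonempty set $F\subset\mathbb R^{d}$, $N_\delta(F)$ is the number of cubes of side length $\delta$ needed to cover $F$. The lower and upper box-counting dimensions are $\underline{\dim}_B(F)=\liminf_{\delta\to0}\frac{\log N_\delta(F)}{-\log\delta}$ and $\overline{\dim}_B(F)=\limsup_{\delta\to0}\frac{\log N_\delta(F)}{-\log\delta}$. If these two values are equal, their common value is the box-counting dimension $\dim_B(F)$ of $F$. *)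

theory Defs
  imports "HOL-Analysis.Analysis"
begin

section \<open>The Sierpinski gasket\<close>

type_synonym plane = "real \<times> real"

text \<open>Only the indices 1, 2, 3 are used; every other index gives the third vertex.\<close>

definition q :: "nat \<Rightarrow> plane" where
  "q n = (if n = 1 then (0, 0) else if n = 2 then (1, 0) else (1/2, sqrt 3 / 2))"

definition l :: "nat \<Rightarrow> plane \<Rightarrow> plane" where
  "l n x = (1/2) *\<^sub>R (x - q n) + q n"

text \<open>Well-definedness of the following description is lemma \<open>gasket_ex1\<close> below.\<close>

definition gasket :: "plane set" where
  "gasket = (THE K. compact K \<and> K \<noteq> {} \<and> K = (\<Union>n\<in>{1,2,3}. l n ` K))"

definition words :: "nat \<Rightarrow> nat list set" where
  "words m = {w. length w = m \<and> set w \<subseteq> {1,2,3}}"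

definition lw :: "nat list \<Rightarrow> plane \<Rightarrow> plane" where
  "lw w = foldr l w"

definition V0 :: "plane set" where
  "V0 = q ` {1,2,3}"

definition V :: "nat \<Rightarrow> plane set" where
  "V m = (\<Union>w\<in>words m. lw w ` V0)"

section \<open>Graph energies and harmonic functions\<close>

definition adj :: "nat \<Rightarrow> plane \<Rightarrow> plane \<Rightarrow> bool" where
  "adj m x y \<longleftrightarrow> x \<noteq> y \<and> (\<exists>w\<in>words m. x \<in> lw w ` V0 \<and> y \<in> lw w ` V0)"

text \<open>The sum runs over ordered pairs, hence the division by 2.\<close>

definition energy :: "nat \<Rightarrow> (plane \<Rightarrow> real) \<Rightarrow> real" where
  "energy m v = (5/3) ^ m * ((\<Sum>(x,y)\<in>{(x,y). adj m x y}. (v x - v y)\<^sup>2) / 2)"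

text \<open>
  Functions on \<open>V m\<close> and on the gasket are represented by total functions on the plane;
  \<open>energy m v\<close> depends only on the values of \<open>v\<close> on \<open>V m\<close>.
\<close>

definition harmonic :: "(plane \<Rightarrow> real) \<Rightarrow> bool" where
  "harmonic h \<longleftrightarrow> continuous_on gasket h \<and>
     (\<forall>m\<ge>1. \<forall>v. (\<forall>x\<in>V0. v x = h x) \<longrightarrow> energy m h \<le> energy m v)"

section \<open>Edelstein contractions\<close>

definition edelstein_contraction :: "real set \<Rightarrow> (real \<Rightarrow> real) \<Rightarrow> bool" where
  "edelstein_contraction J s \<longleftrightarrow> s ` J \<subseteq> J \<and>
     (\<forall>y\<in>J. \<forall>y'\<in>J. y \<noteq> y' \<longrightarrow> \<bar>s y - s y'\<bar> < \<bar>y - y'\<bar>)"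

text \<open>
  The supremum is a real number for an Edelstein contraction, as all quotients are below 1,
  provided that \<open>J\<close> has at least two points; for smaller \<open>J\<close> it is unspecified.
\<close>

definition lip :: "real set \<Rightarrow> (real \<Rightarrow> real) \<Rightarrow> real" where
  "lip J s = Sup {\<bar>s y - s y'\<bar> / \<bar>y - y'\<bar> | y y'. y \<in> J \<and> y' \<in> J \<and> y \<noteq> y'}"

section \<open>Box-counting dimension\<close>

text \<open>
  Least number of axis-parallel closed cubes of side length \<open>\<delta>\<close> covering \<open>F\<close>, meant for
  bounded nonempty \<open>F\<close> and \<open>\<delta> > 0\<close>.
\<close>

definition cover_number :: "real \<Rightarrow> 'a::euclidean_space set \<Rightarrow> nat" where
  "cover_number \<delta> F =
     (LEAST k. \<exists>A. finite A \<and> card A = k \<and> F \<subseteq> (\<Union>a\<in>A. cbox a (a + \<delta> *\<^sub>R One)))"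

definition lower_box_dim :: "'a::euclidean_space set \<Rightarrow> ereal" where
  "lower_box_dim F = Liminf (at_right 0) (\<lambda>\<delta>. ereal (ln (real (cover_number \<delta> F)) / - ln \<delta>))"

definition upper_box_dim :: "'a::euclidean_space set \<Rightarrow> ereal" where
  "upper_box_dim F = Limsup (at_right 0) (\<lambda>\<delta>. ereal (ln (real (cover_number \<delta> F)) / - ln \<delta>))"

text \<open>The box-counting dimension of \<open>F\<close> exists and equals \<open>d\<close>.\<close>

definition has_box_dim :: "'a::euclidean_space set \<Rightarrow> ereal \<Rightarrow> bool" where
  "has_box_dim F d \<longleftrightarrow> lower_box_dim F = d \<and> upper_box_dim F = d"

section \<open>Existence and uniqueness of the gasket\<close>

lemma l_alt: "l n x = (1/2) *\<^sub>R x + (1/2) *\<^sub>R q n"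
  by (auto simp: l_def prod_eq_iff field_simps)

lemma dist_l: "dist (l n x) (l n y) = dist x y / 2"
proof -
  have "l n x - l n y = (1/2) *\<^sub>R (x - y)"
    by (simp add: l_alt algebra_simps)
  then show ?thesis by (simp add: dist_norm)
qed

lemma continuous_on_l: "continuous_on S (l n)"
  unfolding l_def by (intro continuous_intros)

lemma norm_q_le: "norm (q n) \<le> 1"
  by (auto simp: q_def norm_Pair power_divide)

lemma norm_l_le: "norm x \<le> 1 \<Longrightarrow> norm (l n x) \<le> 1"
  using norm_triangle_ineq[of "(1/2) *\<^sub>R x" "(1/2) *\<^sub>R q n"] norm_q_le[of n]
  by (simp add: l_alt)

lemma gasket_exists: "\<exists>K. compact K \<and> K \<noteq> {} \<and> K = (\<Union>n\<in>{1,2,3}. l n ` K)"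
proof -
  define F where "F A = (\<Union>n\<in>{1,2,3}. l n ` A)" for A
  define A where "A i = (F ^^ i) (cball 0 1)" for i
  have Suc: "A (Suc i) = F (A i)" for i by (simp add: A_def)
  have mono: "F S \<subseteq> F T" if "S \<subseteq> T" for S T using that by (auto simp: F_def)
  have comp: "compact (A i) \<and> A i \<noteq> {}" for i
  proof (induction i)
    case 0 then show ?case by (simp add: A_def)
  next
    case (Suc i)
    then show ?case unfolding \<open>A (Suc i) = F (A i)\<close> F_def
      by (auto intro!: compact_UN compact_continuous_image continuous_on_l compact_Un)
  qed
  have step: "A (Suc i) \<subseteq> A i" for i
  proof (induction i)
    case 0 then show ?case using norm_l_le by (auto simp: A_def F_def)
  next
    case (Suc i) then show ?case by (simp only: \<open>\<And>i. A (Suc i) = F (A i)\<close> mono)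
  qed
  have dec: "A j \<subseteq> A i" if "i \<le> j" for i j
    using step that by (rule lift_Suc_antimono_le)
  define K where "K = (\<Inter>i. A i)"
  have K1: "compact K" unfolding K_def using comp by (intro compact_Inter) auto
  have K2: "K \<noteq> {}" unfolding K_def using compact_nest[of A] comp dec by blast
  have K3: "K = F K"
  proof
    show "F K \<subseteq> K"
    proof -
      have "F K \<subseteq> A i" for i
        using mono[of K "A i"] Suc[of i] step[of i] by (auto simp: K_def)
      then show ?thesis by (auto simp: K_def)
    qed
    show "K \<subseteq> F K"
    proof
      fix x assume x: "x \<in> K"
      show "x \<in> F K"
      proof (rule ccontr)
        assume neg: "x \<notin> F K"
        have "\<exists>i. x \<notin> l n ` A i" if "n \<in> {1,2,3}" for n
        proof -
          have *: "l n (2 *\<^sub>R x - q n) = x" by (simp add: l_alt algebra_simps)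
          have "2 *\<^sub>R x - q n \<notin> K"
          proof
            assume "2 *\<^sub>R x - q n \<in> K"
            then have "l n (2 *\<^sub>R x - q n) \<in> F K" unfolding F_def using that by blast
            then show False using neg by (simp only: *)
          qed
          then obtain i where i: "2 *\<^sub>R x - q n \<notin> A i" by (auto simp: K_def)
          have "y = 2 *\<^sub>R x - q n" if "x = l n y" for y
            using that by (simp add: l_alt algebra_simps)
          then show ?thesis using i by blast
        qed
        then obtain i where i: "\<And>n. n \<in> {1,2,3} \<Longrightarrow> x \<notin> l n ` A (i n)" by metis
        define j where "j = Max (i ` {1,2,3})"
        have "x \<notin> l n ` A j" if n: "n \<in> {1,2,3}" for n
        proof -
          have "i n \<le> j" unfolding j_def using n by (intro Max_ge) auto
          then show ?thesis using dec i[OF n] by blast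
        qed
        then have "x \<notin> A (Suc j)" unfolding Suc F_def by blast
        then show False using x by (auto simp: K_def)
      qed
    qed
  qed
  show ?thesis
    by (rule exI[of _ K], rule conjI[OF K1 conjI[OF K2 K3[unfolded F_def]]])
qed

lemma gasket_subset:
  assumes "compact K" "K \<noteq> {}" "K = (\<Union>n\<in>{1,2,3}. l n ` K)"
    and "compact K'" "K' \<noteq> {}" "K' = (\<Union>n\<in>{1,2,3}. l n ` K')"
  shows "K \<subseteq> K'"
proof -
  have "continuous_on K (\<lambda>x. infdist x K')" by (intro continuous_intros)
  then obtain x where x: "x \<in> K" and max: "\<And>y. y \<in> K \<Longrightarrow> infdist y K' \<le> infdist x K'"
    using continuous_attains_sup[OF assms(1,2)] by metis
  obtain n z where n: "n \<in> {1,2,3}" and z: "z \<in> K" and xz: "x = l n z"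
    using subsetD[OF equalityD1[OF assms(3)] x] by (elim UN_E imageE)
  have "closed K'" using assms(4) by (rule compact_imp_closed)
  then obtain y where y: "y \<in> K'" and yz: "infdist z K' = dist z y"
    using infdist_attains_inf[OF _ assms(5)] by metis
  have "l n y \<in> K'" by (rule subsetD[OF equalityD2[OF assms(6)]]) (intro UN_I[OF n] imageI y)
  then have "infdist x K' \<le> dist x (l n y)" by (rule infdist_le)
  also have "\<dots> = infdist z K' / 2" by (simp add: xz dist_l yz)
  also have "\<dots> \<le> infdist x K' / 2" using max[OF z] by simp
  finally have "infdist x K' \<le> 0" by simp
  then have "infdist y K' = 0" if "y \<in> K" for y
    using max[OF that] infdist_nonneg[of y K'] by linarith
  then show ?thesis
    by (intro subsetI) (simp only: in_closed_iff_infdist_zero[OF \<open>closed K'\<close> assms(5)])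
qed

lemma gasket_ex1: "\<exists>!K. compact K \<and> K \<noteq> {} \<and> K = (\<Union>n\<in>{1,2,3}. l n ` K)"
proof (rule ex_ex1I)
  fix K K'
  assume K: "compact K \<and> K \<noteq> {} \<and> K = (\<Union>n\<in>{1,2,3}. l n ` K)"
    and K': "compact K' \<and> K' \<noteq> {} \<and> K' = (\<Union>n\<in>{1,2,3}. l n ` K')"
  note k = conjunct1[OF K] conjunct1[OF conjunct2[OF K]] conjunct2[OF conjunct2[OF K]]
  note k' = conjunct1[OF K'] conjunct1[OF conjunct2[OF K']] conjunct2[OF conjunct2[OF K']]
  show "K = K'"
    by (rule equalityI[OF gasket_subset[OF k k'] gasket_subset[OF k' k]])
qed (rule gasket_exists)

lemma gasket_props:
  "compact gasket" "gasket \<noteq> {}" "gasket = (\<Union>n\<in>{1,2,3}. l n ` gasket)"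
proof -
  have *: "compact gasket \<and> gasket \<noteq> {} \<and> gasket = (\<Union>n\<in>{1,2,3}. l n ` gasket)"
    unfolding gasket_def by (rule theI'[OF gasket_ex1])
  show "compact gasket" by (rule conjunct1[OF *])
  show "gasket \<noteq> {}" by (rule conjunct1[OF conjunct2[OF *]])
  show "gasket = (\<Union>n\<in>{1,2,3}. l n ` gasket)" by (rule conjunct2[OF conjunct2[OF *]])
qed

end

theory Submission
  imports Defs
begin

text \<open>
  Energy minimality makes a harmonic function satisfy a discrete Laplace equation at every new
  vertex, hence the \<open>1/5\<close>-\<open>2/5\<close> extension rule. So its oscillation shrinks by a factor \<open>3/5\<close> from
  a cell to a subcell. By the functional equation the oscillation of \<open>f\<close> on the cell of \<open>n # w\<close> is
  at most \<open>L(s\<^sub>n)\<close> times that on the cell of \<open>w\<close>, plus a multiple of \<open>(3/5)\<close> to the power \<open>length w\<close>.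
  Summed over all words of length \<open>m\<close>, these oscillations are \<open>O(\<rho>\<^sup>m)\<close> for every
  \<open>\<rho> > max \<mu> (9/5)\<close>. Stacking cubes of side \<open>2\<^sup>-\<^sup>m\<close> over each cell covers the graph with
  \<open>O((2\<rho>)\<^sup>m)\<close> cubes; finally let \<open>\<rho>\<close> tend to \<open>max \<mu> (9/5)\<close>.
\<close>

section \<open>Words and cells of the gasket\<close>

lemma lw_Nil [simp]: "lw [] x = x"
  and lw_Cons [simp]: "lw (n # w) x = l n (lw w x)"
  and lw_append [simp]: "lw (v @ w) x = lw v (lw w x)"
  by (simp_all add: lw_def)

lemma inj_l: "l n x = l n y \<longleftrightarrow> x = y"
  by (simp add: l_def)

lemma inj_lw: "lw w x = lw w y \<longleftrightarrow> x = y"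
  by (induction w) (simp_all add: inj_l)

lemma l_q_self: "l n (q n) = q n"
  by (simp add: l_def)

lemma l_q_commute: "l i (q j) = l j (q i)"
  by (simp add: l_alt add.commute)

lemma dist_lw: "dist (lw w x) (lw w y) = dist x y / 2 ^ length w"
  by (induction w) (simp_all add: dist_l field_simps)

lemma lw_diff: "lw w x - lw w y = (1 / 2 ^ length w) *\<^sub>R (x - y)"
proof (induction w)
  case (Cons n w)
  have "lw (n # w) x - lw (n # w) y = (1/2) *\<^sub>R (lw w x - lw w y)"
    by (simp add: l_alt algebra_simps)
  then show ?case by (simp add: Cons.IH)
qed simp

lemma words_0: "words 0 = {[]}"
  by (auto simp: words_def)

lemma words_Suc: "words (Suc m) = (\<lambda>(n, w). n # w) ` ({1,2,3} \<times> words m)"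
proof
  show "words (Suc m) \<subseteq> (\<lambda>(n, w). n # w) ` ({1,2,3} \<times> words m)"
  proof
    fix w assume "w \<in> words (Suc m)"
    then show "w \<in> (\<lambda>(n, w). n # w) ` ({1,2,3} \<times> words m)"
      by (cases w) (auto simp: words_def image_iff)
  qed
qed (auto simp: words_def)

lemma finite_words: "finite (words m)"
  by (induction m) (simp_all add: words_0 words_Suc)

text \<open>Words are split at the first letter, that is at the outermost map, because this is the
  letter that the functional equation of \<open>f\<close> peels off.\<close>

lemma sum_words_Suc:
  "(\<Sum>w\<in>words (Suc m). g w) = (\<Sum>n\<in>{1,2,3}. \<Sum>w\<in>words m. g (n # w))"
proof -
  have "inj_on (\<lambda>(n, w). n # w) ({1,2,3} \<times> words m)"
    by (auto simp: inj_on_def)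
  then show ?thesis
    unfolding words_Suc by (simp only: sum.reindex sum.cartesian_product o_def case_prod_unfold fst_conv snd_conv)
qed

lemma card_words: "card (words m) = 3 ^ m"
proof (induction m)
  case (Suc m)
  have "card (words (Suc m)) = (\<Sum>w\<in>words (Suc m). 1)" by simp
  also have "\<dots> = 3 ^ Suc m" unfolding sum_words_Suc using Suc by simp
  finally show ?case .
qed (simp add: words_0)

section \<open>Points of the gasket and their addresses\<close>

lemma l_gasket: "n \<in> {1,2,3} \<Longrightarrow> x \<in> gasket \<Longrightarrow> l n x \<in> gasket"
  by (rule subsetD[OF equalityD2[OF gasket_props(3)]]) blast

lemma lw_gasket: "set w \<subseteq> {1,2,3} \<Longrightarrow> x \<in> gasket \<Longrightarrow> lw w x \<in> gasket"
  by (induction w) (simp_all add: l_gasket)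

text \<open>Since \<open>q n\<close> is fixed by \<open>l n\<close> and the gasket is mapped into
  itself, applying \<open>l n\<close> to a nearest point halves its distance to \<open>q n\<close>;
  so this distance is zero.\<close>

lemma q_gasket:
  assumes "n \<in> {1,2,3}"
  shows "q n \<in> gasket"
proof -
  have "closed gasket" using gasket_props(1) by (rule compact_imp_closed)
  then obtain y where y: "y \<in> gasket" and d: "infdist (q n) gasket = dist (q n) y"
    using infdist_attains_inf[OF _ gasket_props(2)] by metis
  have "infdist (q n) gasket \<le> dist (q n) (l n y)"
    by (rule infdist_le[OF l_gasket[OF assms y]])
  also have "\<dots> = dist (q n) y / 2"
    using dist_l[of n "q n" y] by (simp only: l_q_self)
  finally have "dist (q n) y = 0" using d zero_le_dist[of "q n" y] by linarith
  then show ?thesis using y by simp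
qed

lemma gasket_in_cell:
  assumes "x \<in> gasket"
  shows "\<exists>w\<in>words m. \<exists>y\<in>gasket. x = lw w y"
proof (induction m)
  case 0
  then show ?case using assms by (simp add: words_0)
next
  case (Suc m)
  then obtain w y where w: "w \<in> words m" and y: "y \<in> gasket" "x = lw w y" by blast
  obtain n z where n: "n \<in> {1,2,3}" and z: "z \<in> gasket" and yz: "y = l n z"
    using subsetD[OF equalityD1[OF gasket_props(3)] y(1)] by (elim UN_E imageE)
  have "w @ [n] \<in> words (Suc m)" using w n by (auto simp: words_def)
  moreover have "x = lw (w @ [n]) z" by (simp add: y yz)
  ultimately show ?case using z by blast
qed

text \<open>At a maximum point \<open>z = l n y\<close> the value of \<open>g\<close> is the mean of
  \<open>g y\<close> and \<open>g (q n)\<close>, so the maximum cannot exceed a vertex value. This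
  replaces the statement that the gasket lies in the convex hull of its vertices.\<close>

lemma gasket_linear_le:
  fixes g :: "plane \<Rightarrow> real"
  assumes "bounded_linear g" and q: "\<And>n. n \<in> {1,2,3} \<Longrightarrow> g (q n) \<le> c" and x: "x \<in> gasket"
  shows "g x \<le> c"
proof -
  interpret bounded_linear g by fact
  obtain z where z: "z \<in> gasket" and max: "\<And>y. y \<in> gasket \<Longrightarrow> g y \<le> g z"
    using continuous_attains_sup[OF gasket_props(1,2) continuous_on[OF continuous_on_id]] by auto
  obtain n y where n: "n \<in> {1,2,3}" and y: "y \<in> gasket" and zy: "z = l n y"
    using subsetD[OF equalityD1[OF gasket_props(3)] z] by (elim UN_E imageE)
  have "g z = g y / 2 + g (q n) / 2"
    by (simp add: zy l_alt add scaleR)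
  then show ?thesis using max[OF y] q[OF n] max[OF x] by linarith
qed

lemma gasket_unit_square:
  assumes "x \<in> gasket"
  shows "0 \<le> fst x" "fst x \<le> 1" "0 \<le> snd x" "snd x \<le> 1"
proof -
  have s: "sqrt 3 / 2 \<le> 1"
    using real_sqrt_le_mono[of 3 4] by simp
  have "- fst x \<le> 0" by (rule gasket_linear_le[OF _ _ assms]) (auto intro!: bounded_linear_minus bounded_linear_fst bounded_linear_snd simp: q_def)
  moreover have "- snd x \<le> 0" by (rule gasket_linear_le[OF _ _ assms]) (auto intro!: bounded_linear_minus bounded_linear_fst bounded_linear_snd simp: q_def)
  ultimately
  show "0 \<le> fst x" "0 \<le> snd x" by simp_all
  show "fst x \<le> 1" by (rule gasket_linear_le[OF _ _ assms]) (auto intro!: bounded_linear_minus bounded_linear_fst bounded_linear_snd simp: q_def)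
  show "snd x \<le> 1" by (rule gasket_linear_le[OF _ _ assms]) (use s in \<open>auto intro!: bounded_linear_fst bounded_linear_snd simp: q_def\<close>)
qed

section \<open>Barycentric coordinates and the graph structure\<close>

text \<open>Barycentric coordinates with respect to the three vertices. In them each
  \<open>l n\<close> halves all coordinates and adds 1/2 to the \<open>n\<close>-th, so that
  questions about meeting cells become arithmetic.\<close>

definition bary :: "nat \<Rightarrow> plane \<Rightarrow> real" where
  "bary k x = (if k = 1 then 1 - fst x - snd x / sqrt 3
     else if k = 2 then fst x - snd x / sqrt 3 else 2 * snd x / sqrt 3)"

definition triangle :: "plane set" where
  "triangle = {x. \<forall>k\<in>{1,2,3}. 0 \<le> bary k x}"

lemma bary_q: "k \<in> {1,2,3} \<Longrightarrow> n \<in> {1,2,3} \<Longrightarrow> bary k (q n) = (if k = n then 1 else 0)"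
  by (auto simp: bary_def q_def)

lemma bary_l:
  assumes "k \<in> {1,2,3}" "n \<in> {1,2,3}"
  shows "bary k (l n x) = (bary k x + (if k = n then 1 else 0)) / 2"
proof -
  have "bary k (l n x) = (bary k x + bary k (q n)) / 2"
    by (simp add: bary_def l_alt add_divide_distrib diff_divide_distrib distrib_left)
  then show ?thesis using assms by (simp add: bary_q del: insert_iff)
qed

lemma bary_sum: "bary 1 x + bary 2 x + bary 3 x = 1"
  by (simp add: bary_def)

lemma bary_eqI:
  assumes "\<And>k. k \<in> {1,2,3} \<Longrightarrow> bary k x = bary k y"
  shows "x = y"
  using assms[of 2] assms[of 3] by (simp add: bary_def prod_eq_iff)

lemma q_triangle: "n \<in> {1,2,3} \<Longrightarrow> q n \<in> triangle"
  by (auto simp: triangle_def bary_q simp del: One_nat_def)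

lemma l_triangle: "n \<in> {1,2,3} \<Longrightarrow> x \<in> triangle \<Longrightarrow> l n x \<in> triangle"
  by (simp add: triangle_def bary_l del: insert_iff One_nat_def ball_simps)

lemma lw_triangle: "set w \<subseteq> {1,2,3} \<Longrightarrow> x \<in> triangle \<Longrightarrow> lw w x \<in> triangle"
  by (induction w) (simp_all add: l_triangle)

section \<open>How cells meet\<close>

lemma triangle_bary_eq_1:
  assumes "x \<in> triangle" "p \<in> {1,2,3}" "1 \<le> bary p x"
  shows "x = q p"
proof (rule bary_eqI)
  fix k :: nat assume k: "k \<in> {1,2,3}"
  have "0 \<le> bary 1 x" "0 \<le> bary 2 x" "0 \<le> bary 3 x"
    using assms(1) by (auto simp: triangle_def)
  then show "bary k x = bary k (q p)"
    using assms(2,3) k bary_sum[of x] by (auto simp: bary_q simp del: One_nat_def)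
qed

lemma q_inj: "i \<in> {1,2,3} \<Longrightarrow> j \<in> {1,2,3} \<Longrightarrow> q i = q j \<longleftrightarrow> i = j"
  using bary_q[of i i] bary_q[of i j] by (metis zero_neq_one)

text \<open>On the image of \<open>l n\<close> the \<open>p\<close>-th coordinate is at most 1/2, on
  that of \<open>l p\<close> at least 1/2. A common point forces \<open>bary p x\<close> to be
  1.\<close>

lemma triangle_meet:
  assumes "x \<in> triangle" "y \<in> triangle" "n \<in> {1,2,3}" "p \<in> {1,2,3}" "n \<noteq> p" "l n x = l p y"
  shows "x = q p"
proof (rule triangle_bary_eq_1[OF assms(1,4)])
  have "bary p (l n x) = bary p (l p y)" by (simp add: assms)
  moreover have "0 \<le> bary p y" using assms(2,4) by (auto simp: triangle_def)
  ultimately show "1 \<le> bary p x" using assms(3-5) by (simp add: bary_l del: insert_iff)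
qed

text \<open>A corner is an extreme point: as \<open>q p = l p (q p)\<close>, either the outermost
  map is \<open>l p\<close> and is cancelled by injectivity, or two different subtriangles meet and
  \<open>triangle_meet\<close> applies.\<close>

lemma lw_eq_q:
  assumes "set w \<subseteq> {1,2,3}" "y \<in> triangle" "p \<in> {1,2,3}" "lw w y = q p"
  shows "y = q p"
  using assms(1,4)
proof (induction w)
  case (Cons n w)
  have eq: "l n (lw w y) = l p (q p)" using Cons.prems by (simp add: l_q_self)
  have "lw w y \<in> triangle" using lw_triangle assms(2) Cons.prems by simp
  then have "lw w y = q p"
    using triangle_meet[OF _ q_triangle[OF assms(3)] _ assms(3) _ eq] eq Cons.prems
    by (cases "n = p") (auto simp: inj_l)
  then show ?case using Cons by simp
qed simp

text \<open>A midpoint of a side of the cell \<open>w\<close> is a vertex of just two cells of the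
  next level. In the induction, if the first letters of \<open>v\<close> and \<open>w\<close>
  differ, the midpoint would be a corner of the cell; writing it both as \<open>l i (q j)\<close>
  and as \<open>l j (q i)\<close> then gives \<open>q i = q j\<close>.\<close>

lemma junction_cells:
  assumes "length v = Suc (length w)" "set v \<subseteq> {1,2,3}" "set w \<subseteq> {1,2,3}"
    and ijk: "i \<in> {1,2,3}" "j \<in> {1,2,3}" "k \<in> {1,2,3}" "i \<noteq> j"
    and "lw v (q k) = lw w (l i (q j))"
  shows "v = w @ [i] \<and> k = j \<or> v = w @ [j] \<and> k = i"
  using assms(1-3,8)
proof (induction w arbitrary: v)
  case Nil
  then obtain n where v: "v = [n]" by (cases v) auto
  then have n: "n \<in> {1,2,3}" using Nil by simp
  have eq: "l n (q k) = l i (q j)" using Nil v by simp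
  show ?case
  proof (cases "n = i")
    case True
    then show ?thesis using eq v ijk by (simp add: inj_l q_inj del: insert_iff)
  next
    case False
    have "q k = q i"
      by (rule triangle_meet[OF q_triangle[OF ijk(3)] q_triangle[OF ijk(2)] n ijk(1) False eq])
    moreover have "q j = q n"
      by (rule triangle_meet[OF q_triangle[OF ijk(2)] q_triangle[OF ijk(3)] ijk(1) n False[symmetric] eq[symmetric]])
    ultimately show ?thesis using v n ijk by (simp add: q_inj del: insert_iff)
  qed
next
  case (Cons n w)
  then obtain p v' where v: "v = p # v'" by (cases v) auto
  have p: "p \<in> {1,2,3}" "set v' \<subseteq> {1,2,3}" and n: "n \<in> {1,2,3}" "set w \<subseteq> {1,2,3}"
    using Cons.prems v by auto
  have eq: "l n (lw w (l i (q j))) = l p (lw v' (q k))" using Cons.prems v by simp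
  have t: "l i (q j) \<in> triangle" using ijk by (intro l_triangle q_triangle)
  show ?case
  proof (cases "n = p")
    case True
    have "v' = w @ [i] \<and> k = j \<or> v' = w @ [j] \<and> k = i"
      by (rule Cons.IH) (use Cons.prems v eq True in \<open>auto simp: inj_l\<close>)
    then show ?thesis using v True by simp
  next
    case False
    have "lw w (l i (q j)) = q p"
      by (rule triangle_meet[OF lw_triangle[OF n(2) t]
            lw_triangle[OF p(2) q_triangle[OF ijk(3)]] n(1) p(1) False eq])
    then have "l i (q j) = q p" by (rule lw_eq_q[OF n(2) t p(1)])
    then have "lw [i] (q j) = q p" by simp
    then have "q j = q p" using lw_eq_q[of "[i]" "q j" p] ijk p q_triangle by simp
    moreover have "lw [j] (q i) = q p" using \<open>l i (q j) = q p\<close> by (simp add: l_q_commute)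
    then have "q i = q p" using lw_eq_q[of "[j]" "q i" p] ijk p q_triangle by simp
    ultimately have "q i = q j" by simp
    then show ?thesis using ijk by (simp add: q_inj del: insert_iff)
  qed
qed

text \<open>The neighbours are the remaining vertices of the two cells found in
  \<open>junction_cells\<close>: two old vertices of the cell and its two other midpoints.\<close>

lemma adj_junction:
  assumes "w \<in> words m" and ijr: "{i, j, r} = {1,2,3}" "i \<noteq> j" "j \<noteq> r" "i \<noteq> r"
  shows "{b. adj (Suc m) (lw w (l i (q j))) b} =
    {lw w (q i), lw w (q j), lw w (l i (q r)), lw w (l j (q r))}" (is "?A = ?B")
proof -
  let ?x = "lw w (l i (q j))"
  have i: "i \<in> {1,2,3}" and j: "j \<in> {1,2,3}" and r: "r \<in> {1,2,3}" using ijr by blast+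
  have w: "length w = m" "set w \<subseteq> {1,2,3}" using assms by (auto simp: words_def)
  have V0: "V0 = {q i, q j, q r}" unfolding V0_def ijr(1)[symmetric] by simp
  have wi: "w @ [i] \<in> words (Suc m)" "w @ [j] \<in> words (Suc m)"
    using w i j by (auto simp: words_def)
  have cells: "v \<in> words (Suc m) \<and> ?x \<in> lw v ` V0 \<longleftrightarrow> v = w @ [i] \<or> v = w @ [j]" for v
  proof
    assume "v \<in> words (Suc m) \<and> ?x \<in> lw v ` V0"
    then have v: "length v = Suc (length w)" "set v \<subseteq> {1,2,3}" and "?x \<in> lw v ` q ` {1,2,3}"
      using w by (simp_all add: words_def V0_def del: image_insert)
    then obtain k where k: "k \<in> {1,2,3}" "lw v (q k) = ?x" by (elim imageE) (simp del: insert_iff)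
    show "v = w @ [i] \<or> v = w @ [j]"
      using junction_cells[OF v w(2) i j k(1) ijr(2) k(2)] by blast
  next
    assume "v = w @ [i] \<or> v = w @ [j]"
    moreover have "?x = lw (w @ [i]) (q j)" "?x = lw (w @ [j]) (q i)"
      by (simp_all add: l_q_commute[of i j])
    ultimately show "v \<in> words (Suc m) \<and> ?x \<in> lw v ` V0"
      using wi unfolding V0 by blast
  qed
  have "adj (Suc m) ?x b \<longleftrightarrow> ?x \<noteq> b \<and> (b \<in> lw (w @ [i]) ` V0 \<or> b \<in> lw (w @ [j]) ` V0)" for b
    unfolding adj_def using cells by metis
  then have "?A = (lw (w @ [i]) ` V0 \<union> lw (w @ [j]) ` V0) - {?x}" by auto
  also have "\<dots> = {lw w (q i), ?x, lw w (q j), lw w (l i (q r)), lw w (l j (q r))} - {?x}"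
    unfolding V0 by (simp add: l_q_self l_q_commute[of j i] insert_commute Un_commute)
  also have "\<dots> = ?B"
  proof -
    have "l i (q j) \<noteq> l i (q r)" using ijr i j r by (simp add: inj_l q_inj del: insert_iff)
    moreover have "l i (q j) \<noteq> l j (q r)"
      unfolding l_q_commute[of i j] using ijr i j r by (simp add: inj_l q_inj del: insert_iff)
    moreover have "l i (q j) \<noteq> l i (q i)" using ijr i j r by (simp add: inj_l q_inj del: insert_iff)
    moreover have "l i (q j) \<noteq> l j (q j)"
      unfolding l_q_commute[of i j] using ijr i j r by (simp add: inj_l q_inj del: insert_iff)
    ultimately have "?x \<notin> ?B" by (simp add: inj_lw l_q_self)
    then show ?thesis by blast
  qed
  finally show ?thesis .
qed

lemma finite_adj: "finite {(x, y). adj m x y}"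
proof (rule finite_subset)
  show "{(x, y). adj m x y} \<subseteq> V m \<times> V m" by (auto simp: adj_def V_def)
  show "finite (V m \<times> V m)" by (auto simp: V_def V0_def finite_words)
qed

section \<open>Harmonic functions\<close>

text \<open>First variation: changing the value at \<open>x\<close> by \<open>t\<close> changes the
  sum by twice \<open>2 * t * S + t\<^sup>2 * d\<close>, the factor two coming from ordered pairs.
  This is nonnegative for every \<open>t\<close> only if the linear coefficient vanishes.\<close>

lemma laplacian_zero:
  fixes h :: "'a \<Rightarrow> real"
  assumes fin: "finite {(a, b). R a b}" and sym: "\<And>a b. R a b \<Longrightarrow> R b a" and irr: "\<not> R x x"
    and min: "\<And>t. (\<Sum>(a,b)\<in>{(a,b). R a b}. (h a - h b)\<^sup>2)
      \<le> (\<Sum>(a,b)\<in>{(a,b). R a b}. ((h(x := h x + t)) a - (h(x := h x + t)) b)\<^sup>2)"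
  shows "(\<Sum>b | R x b. h x - h b) = 0"
proof -
  let ?E = "{(a,b). R a b}"
  define S d where "S = (\<Sum>b | R x b. h x - h b)" and "d = real (card {b. R x b})"
  have half: "(\<Sum>(a,b)\<in>?E. if a = x then g b else 0) = (\<Sum>b | R x b. g b)" for g :: "'a \<Rightarrow> real"
  proof -
    have "(\<Sum>(a,b)\<in>?E. if a = x then g b else 0) = (\<Sum>(a,b)\<in>Pair x ` {b. R x b}. if a = x then g b else 0)"
      by (rule sum.mono_neutral_right[OF fin]) auto
    then show ?thesis by (simp add: sum.reindex inj_on_def)
  qed
  have swap: "(\<Sum>(a,b)\<in>?E. if b = x then g a else 0) = (\<Sum>(a,b)\<in>?E. if a = x then g b else 0)"
    for g :: "'a \<Rightarrow> real"
    by (rule sum.reindex_bij_witness[of _ prod.swap prod.swap]) (auto intro: sym)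
  have quad: "0 \<le> 2 * t * S + t\<^sup>2 * d" for t
  proof -
    let ?v = "h(x := h x + t)" and ?g = "\<lambda>b. 2 * t * (h x - h b) + t\<^sup>2"
    have "(\<Sum>(a,b)\<in>?E. (?v a - ?v b)\<^sup>2) - (\<Sum>(a,b)\<in>?E. (h a - h b)\<^sup>2)
      = (\<Sum>(a,b)\<in>?E. (?v a - ?v b)\<^sup>2 - (h a - h b)\<^sup>2)"
      by (simp add: sum_subtractf case_prod_unfold)
    also have "\<dots> = (\<Sum>(a,b)\<in>?E. (if a = x then ?g b else 0) + (if b = x then ?g a else 0))"
      using irr by (intro sum.cong refl) (auto simp: power2_eq_square algebra_simps)
    also have "\<dots> = 2 * (\<Sum>b | R x b. ?g b)"
      using swap[of ?g] half[of ?g] by (simp add: case_prod_unfold sum.distrib)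
    also have "(\<Sum>b | R x b. ?g b) = 2 * t * S + t\<^sup>2 * d"
      by (simp add: sum.distrib S_def d_def sum_distrib_left)
    finally have "(\<Sum>(a,b)\<in>?E. (?v a - ?v b)\<^sup>2) - (\<Sum>(a,b)\<in>?E. (h a - h b)\<^sup>2)
      = 2 * (2 * t * S + t\<^sup>2 * d)" .
    moreover have "0 \<le> (\<Sum>(a,b)\<in>?E. (?v a - ?v b)\<^sup>2) - (\<Sum>(a,b)\<in>?E. (h a - h b)\<^sup>2)"
      by (rule diff_ge_0_iff_ge[THEN iffD2, OF min])
    ultimately show ?thesis by (simp only: zero_le_mult_iff) auto
  qed
  have d: "0 \<le> d" by (simp add: d_def)
  \<comment> \<open>The test value would naturally be \<open>- S / d\<close>; the denominator
    \<open>d + 1\<close> avoids dividing by zero when \<open>x\<close> has no neighbours and still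
    gives a negative multiple of the square of \<open>S\<close>.\<close>
  have "2 * (- S / (d + 1)) * S + (- S / (d + 1))\<^sup>2 * d = - (S\<^sup>2 * (d + 2) / (d + 1)\<^sup>2)"
    using d by (simp add: divide_simps power2_eq_square) (simp add: algebra_simps)
  with quad[of "- S / (d + 1)"] have "S\<^sup>2 * (d + 2) / (d + 1)\<^sup>2 \<le> 0" by linarith
  then have "S\<^sup>2 \<le> 0" using d by (simp add: divide_le_0_iff mult_le_0_iff)
  then show ?thesis by (simp add: S_def)
qed

text \<open>Changing \<open>h\<close> only at \<open>x\<close> keeps the boundary values, so the
  changed function is an admissible competitor for the energy.\<close>

lemma harmonic_laplacian:
  assumes "harmonic h" "x \<notin> V0"
  shows "(\<Sum>b | adj (Suc m) x b. h x - h b) = 0"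
proof (rule laplacian_zero[OF finite_adj])
  fix t
  have "energy (Suc m) h \<le> energy (Suc m) (h(x := h x + t))"
    using assms unfolding harmonic_def by (metis fun_upd_apply le_add1 plus_1_eq_Suc)
  then show "(\<Sum>(a,b)\<in>{(a,b). adj (Suc m) a b}. (h a - h b)\<^sup>2)
      \<le> (\<Sum>(a,b)\<in>{(a,b). adj (Suc m) a b}. ((h(x := h x + t)) a - (h(x := h x + t)) b)\<^sup>2)"
    by (simp add: energy_def del: fun_upd_apply power_Suc)
qed (auto simp: adj_def)

lemma harmonic_mean:
  assumes "harmonic h" "w \<in> words m" and ijr: "{i, j, r} = {1,2,3}" "i \<noteq> j" "j \<noteq> r" "i \<noteq> r"
  shows "4 * h (lw w (l i (q j))) =
    h (lw w (q i)) + h (lw w (q j)) + h (lw w (l i (q r))) + h (lw w (l j (q r)))"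
proof -
  let ?x = "lw w (l i (q j))"
  have idx: "i \<in> {1,2,3}" "j \<in> {1,2,3}" "r \<in> {1,2,3}" using ijr by blast+
  have w: "set w \<subseteq> {1,2,3}" using assms by (auto simp: words_def)
  \<comment> \<open>A corner is never a midpoint: both descriptions of the midpoint would make two
    distinct vertices equal to that corner.\<close>
  have ne: "q a \<noteq> l b (q c)" if "a \<in> {1,2,3}" "b \<in> {1,2,3}" "c \<in> {1,2,3}" "b \<noteq> c" for a b c
  proof
    assume "q a = l b (q c)"
    then have *: "lw [b] (q c) = q a" "lw [c] (q b) = q a" by (simp_all add: l_q_commute)
    have "q c = q a" by (rule lw_eq_q[OF _ _ _ *(1)]) (use that q_triangle in auto)
    moreover have "q b = q a" by (rule lw_eq_q[OF _ _ _ *(2)]) (use that q_triangle in auto)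
    ultimately show False using that by (simp add: q_inj del: insert_iff)
  qed
  have "?x \<notin> V0"
  proof
    assume "?x \<in> V0"
    then obtain p where p: "p \<in> {1,2,3}" "?x = q p" by (auto simp: V0_def)
    have "l i (q j) = q p"
      by (rule lw_eq_q[OF w _ p]) (intro l_triangle q_triangle idx)
    then show False using ne[OF p(1) idx(1,2) ijr(2)] by simp
  qed
  then have "(\<Sum>b | adj (Suc m) ?x b. h ?x - h b) = 0" by (rule harmonic_laplacian[OF assms(1)])
  then have *: "(\<Sum>b\<in>{lw w (q i), lw w (q j), lw w (l i (q r)), lw w (l j (q r))}. h ?x - h b) = 0"
    by (simp only: adj_junction[OF assms(2) ijr])
  \<comment> \<open>The four neighbours must be pairwise distinct for the sum over the set to have
    four terms.\<close>
  have "lw w (q i) \<noteq> lw w (q j)" "lw w (l i (q r)) \<noteq> lw w (l j (q r))"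
    using ijr idx by (simp_all add: inj_lw q_inj l_q_commute[of _ r] inj_l del: insert_iff)
  moreover have "lw w (q a) \<noteq> lw w (l b (q r))" if "a \<in> {i, j}" "b \<in> {i, j}" for a b
    using ne[of a b r] that ijr idx by (auto simp: inj_lw)
  ultimately show ?thesis using * by simp
qed

text \<open>The three mean value equations of a cell determine its new vertex values (the \<open>1/5\<close>-\<open>2/5\<close> rule).\<close>

lemma harmonic_extension:
  assumes "harmonic h" "w \<in> words m" and ijr: "{i, j, r} = {1,2,3}" "i \<noteq> j" "j \<noteq> r" "i \<noteq> r"
  shows "h (lw w (l i (q j))) = (2 * h (lw w (q i)) + 2 * h (lw w (q j)) + h (lw w (q r))) / 5"
proof -
  have e: "{i, r, j} = {1,2,3}" "{j, r, i} = {1,2,3}" using ijr(1) by (simp_all only: insert_commute)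
  have "4 * h (lw w (l i (q r))) =
    h (lw w (q i)) + h (lw w (q r)) + h (lw w (l i (q j))) + h (lw w (l j (q r)))"
    using harmonic_mean[OF assms(1,2) e(1)] ijr by (simp add: l_q_commute[of r j])
  moreover have "4 * h (lw w (l j (q r))) =
    h (lw w (q j)) + h (lw w (q r)) + h (lw w (l i (q j))) + h (lw w (l i (q r)))"
    using harmonic_mean[OF assms(1,2) e(2)] ijr by (simp add: l_q_commute[of r i] l_q_commute[of j i])
  moreover have "x = (2 * a + 2 * b + c) / 5"
    if "4 * y = a + c + x + z" "4 * z = b + c + x + y" "4 * x = a + b + y + z" for x y z a b c :: real
    using that by (simp add: field_simps)
  ultimately show ?thesis using harmonic_mean[OF assms] by blast
qed

text \<open>The extension rule in one form for all corners of a subcell, so that later inductions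
  need no case split on \<open>i = j\<close>.\<close>

lemma harmonic_subcell:
  assumes "harmonic h" "w \<in> words m" "i \<in> {1,2,3}" "j \<in> {1,2,3}"
  shows "\<exists>r\<in>{1,2,3}. h (lw (w @ [i]) (q j)) = (2 * h (lw w (q i)) + 2 * h (lw w (q j)) + h (lw w (q r))) / 5"
proof (cases "i = j")
  case True
  \<comment> \<open>The corner kept by the subcell also fits the formula: with \<open>r = i\<close>
    all weights fall on the same value.\<close>
  then show ?thesis using assms(3) by (intro bexI[of _ i]) (simp_all add: l_q_self)
next
  case False
  \<comment> \<open>The indices 1, 2, 3 add up to 6, so this is the third one.\<close>
  define r where "r = 6 - i - j"
  have r: "{i, j, r} = {1,2,3}" "j \<noteq> r" "i \<noteq> r"
    unfolding r_def using assms(3,4) False by (elim insertE emptyE; simp add: insert_commute)+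
  then have "r \<in> {1,2,3}" by blast
  moreover have "h (lw (w @ [i]) (q j)) = (2 * h (lw w (q i)) + 2 * h (lw w (q j)) + h (lw w (q r))) / 5"
    using harmonic_extension[OF assms(1,2) r(1) False r(2,3)] by simp
  ultimately show ?thesis by blast
qed

section \<open>Maximum principle and decay of oscillation\<close>

lemma harmonic_vertices_between:
  assumes h: "harmonic h" and w: "set w \<subseteq> {1,2,3}"
    and bd: "\<And>k. k \<in> {1,2,3} \<Longrightarrow> h (lw w (q k)) \<in> {a..b}"
    and v: "set v \<subseteq> {1,2,3}" and k: "k \<in> {1,2,3}"
  shows "h (lw (w @ v) (q k)) \<in> {a..b}"
  using v k
proof (induction v arbitrary: k rule: rev_induct)
  case (snoc n v)
  have "w @ v \<in> words (length (w @ v))" using w snoc.prems by (auto simp: words_def)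
  \<comment> \<open>The new value is a convex combination with weights 2/5, 2/5 and 1/5 of the
    parent's vertex values.\<close>
  then obtain r where "r \<in> {1,2,3}" "h (lw ((w @ v) @ [n]) (q k)) =
      (2 * h (lw (w @ v) (q n)) + 2 * h (lw (w @ v) (q k)) + h (lw (w @ v) (q r))) / 5"
    using harmonic_subcell[OF h, of "w @ v" _ n k] snoc.prems by auto
  then show ?case
    using snoc.IH[of n] snoc.IH[of k] snoc.IH[of r] snoc.prems by simp
qed (use bd in simp)

text \<open>Vertices of smaller and smaller cells around the point converge to it; bounds at the
  vertices pass to the limit by continuity of \<open>h\<close>.\<close>

lemma harmonic_between:
  assumes h: "harmonic h" and w: "set w \<subseteq> {1,2,3}"
    and bd: "\<And>k. k \<in> {1,2,3} \<Longrightarrow> h (lw w (q k)) \<in> {a..b}" and x: "x \<in> gasket"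
  shows "h (lw w x) \<in> {a..b}"
proof -
  have "\<exists>v y. v \<in> words m \<and> y \<in> gasket \<and> x = lw v y" for m
    using gasket_in_cell[OF x] by blast
  then obtain v y where v: "\<And>m. v m \<in> words m" and y: "\<And>m. y m \<in> gasket" "\<And>m. x = lw (v m) (y m)"
    by metis
  let ?z = "\<lambda>m. lw w (lw (v m) (q 1))"
  have q1: "q 1 \<in> gasket" by (rule q_gasket) simp
  have vs: "set (v m) \<subseteq> {1,2,3}" for m using v[of m] by (simp add: words_def)
  obtain M where M: "\<And>z. z \<in> gasket \<Longrightarrow> dist (q 1) z \<le> M"
    using compact_imp_bounded[OF gasket_props(1)] bounded_any_center[of gasket "q 1"] by metis
  have le: "dist (?z m) (lw w x) \<le> M * (1/2) ^ m" for m
  proof -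
    have "dist (?z m) (lw w x) = dist (q 1) (y m) / 2 ^ length w / 2 ^ m"
      using v[of m] by (subst y(2)[of m]) (simp add: dist_lw words_def)
    also have "\<dots> \<le> M / 2 ^ m"
    proof (rule divide_right_mono)
      have "dist (q 1) (y m) / 2 ^ length w \<le> dist (q 1) (y m) / 1"
        by (intro divide_left_mono) simp_all
      then show "dist (q 1) (y m) / 2 ^ length w \<le> M" using M[OF y(1)[of m]] by simp
    qed simp
    finally show ?thesis by (simp add: power_divide)
  qed
  have "(\<lambda>m. M * (1/2) ^ m) \<longlonglongrightarrow> 0"
    by (intro tendsto_mult_right_zero LIMSEQ_power_zero) simp
  then have "(\<lambda>m. dist (?z m) (lw w x)) \<longlonglongrightarrow> 0"
    by (rule Lim_null_comparison[rotated]) (simp add: le del: One_nat_def)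
  then have lim: "?z \<longlonglongrightarrow> lw w x" by (rule tendsto_dist_iff[THEN iffD2])
  have "(\<lambda>m. h (?z m)) \<longlonglongrightarrow> h (lw w x)"
  proof (rule continuous_on_tendsto_compose[OF _ lim lw_gasket[OF w x]])
    show "continuous_on gasket h" using h by (simp add: harmonic_def)
    show "\<forall>\<^sub>F m in sequentially. ?z m \<in> gasket"
      by (intro always_eventually allI lw_gasket[OF w] lw_gasket[OF vs] q1)
  qed
  moreover have "h (?z m) \<in> {a..b}" for m
    using harmonic_vertices_between[OF h w bd vs, where k = 1] by simp
  ultimately show ?thesis by (rule closed_sequentially[OF closed_atLeastAtMost, rotated])
qed

text \<open>Two corners of a subcell share the contribution of the kept corner \<open>n\<close>. It
  cancels in their difference, and what stays has total weight 2/5 + 1/5 = 3/5.\<close>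

lemma harmonic_vertices_decay:
  assumes h: "harmonic h"
  shows "\<exists>D\<ge>0. \<forall>w i j. set w \<subseteq> {1,2,3} \<longrightarrow> i \<in> {1,2,3} \<longrightarrow> j \<in> {1,2,3} \<longrightarrow>
    h (lw w (q i)) - h (lw w (q j)) \<le> D * (3/5) ^ length w"
proof -
  define D where "D = (\<Sum>i\<in>{1,2,3}. \<Sum>j\<in>{1,2,3}. \<bar>h (q i) - h (q j)\<bar>)"
  have base: "h (q i) - h (q j) \<le> D" if "i \<in> {1,2,3}" "j \<in> {1,2,3}" for i j
  proof -
    have "\<bar>h (q i) - h (q j)\<bar> \<le> (\<Sum>j\<in>{1,2,3}. \<bar>h (q i) - h (q j)\<bar>)"
      by (rule member_le_sum[OF that(2)]) simp_all
    also have "\<dots> \<le> D" unfolding D_def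
      by (rule member_le_sum[OF that(1)]) (simp_all add: sum_nonneg)
    finally show ?thesis by linarith
  qed
  have "h (lw w (q i)) - h (lw w (q j)) \<le> D * (3/5) ^ length w"
    if "set w \<subseteq> {1,2,3}" "i \<in> {1,2,3}" "j \<in> {1,2,3}" for w i j
    using that
  proof (induction w arbitrary: i j rule: rev_induct)
    case Nil
    then show ?case using base by simp
  next
    case (snoc n w)
    have w: "w \<in> words (length w)" and n: "n \<in> {1,2,3}" using snoc.prems by (auto simp: words_def)
    let ?E = "D * (3/5) ^ length w" and ?H = "\<lambda>k. h (lw w (q k))"
    obtain r where r: "r \<in> {1,2,3}"
      "h (lw (w @ [n]) (q i)) = (2 * ?H n + 2 * ?H i + ?H r) / 5"
      using harmonic_subcell[OF h w n snoc.prems(2)] by blast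
    obtain r' where r': "r' \<in> {1,2,3}"
      "h (lw (w @ [n]) (q j)) = (2 * ?H n + 2 * ?H j + ?H r') / 5"
      using harmonic_subcell[OF h w n snoc.prems(3)] by blast
    have w': "set w \<subseteq> {1,2,3}" using snoc.prems by simp
    have "?H i - ?H j \<le> ?E" "?H r - ?H r' \<le> ?E"
      using snoc.IH[OF w'] snoc.prems(2,3) r(1) r'(1) by blast+
    moreover have "h (lw (w @ [n]) (q i)) - h (lw (w @ [n]) (q j))
        = (2 * (?H i - ?H j) + (?H r - ?H r')) / 5"
      unfolding r(2) r'(2) by (simp add: field_simps)
    ultimately have "h (lw (w @ [n]) (q i)) - h (lw (w @ [n]) (q j)) \<le> (2 * ?E + ?E) / 5"
      by (simp only:) (intro divide_right_mono add_mono mult_left_mono; simp)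
    also have "\<dots> = D * (3/5) ^ length (w @ [n])" by simp
    finally show ?case .
  qed
  moreover have "0 \<le> D" by (simp add: D_def sum_nonneg)
  ultimately show ?thesis by blast
qed

text \<open>By the maximum principle the oscillation on a cell is at most the largest difference of
  its vertex values, which decays geometrically.\<close>

lemma harmonic_decay:
  assumes h: "harmonic h"
  obtains D where "0 \<le> D"
    "\<And>w x y. set w \<subseteq> {1,2,3} \<Longrightarrow> x \<in> gasket \<Longrightarrow> y \<in> gasket \<Longrightarrow>
      \<bar>h (lw w x) - h (lw w y)\<bar> \<le> D * (3/5) ^ length w"
proof -
  obtain D where D: "0 \<le> D" "\<And>w i j. set w \<subseteq> {1,2,3} \<Longrightarrow> i \<in> {1,2,3} \<Longrightarrow> j \<in> {1,2,3} \<Longrightarrow>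
    h (lw w (q i)) - h (lw w (q j)) \<le> D * (3/5) ^ length w"
    using harmonic_vertices_decay[OF h] by blast
  have "\<bar>h (lw w x) - h (lw w y)\<bar> \<le> D * (3/5) ^ length w"
    if w: "set w \<subseteq> {1,2,3}" and x: "x \<in> gasket" and y: "y \<in> gasket" for w x y
  proof -
    let ?S = "(\<lambda>k. h (lw w (q k))) ` {1,2,3}"
    have fin: "finite ?S" "?S \<noteq> {}" by simp_all
    obtain i j where i: "i \<in> {1,2,3}" "Max ?S = h (lw w (q i))" and j: "j \<in> {1,2,3}" "Min ?S = h (lw w (q j))"
      using Max_in[OF fin] Min_in[OF fin] by (elim imageE) blast
    have bd: "h (lw w (q k)) \<in> {Min ?S..Max ?S}" if "k \<in> {1,2,3}" for k
      unfolding atLeastAtMost_iff using fin(1) that by (intro conjI Min_le Max_ge imageI) blast+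
    have "h (lw w x) \<in> {Min ?S..Max ?S}" "h (lw w y) \<in> {Min ?S..Max ?S}"
      using harmonic_between[OF h w bd] x y by blast+
    then have "\<bar>h (lw w x) - h (lw w y)\<bar> \<le> Max ?S - Min ?S"
      unfolding atLeastAtMost_iff by linarith
    also have "\<dots> \<le> D * (3/5) ^ length w" unfolding i(2) j(2) by (rule D(2)[OF w i(1) j(1)])
    finally show ?thesis .
  qed
  then show ?thesis using D(1) that by blast
qed

section \<open>Box counting\<close>

text \<open>The Edelstein condition bounds all quotients by 1, so the supremum is a genuine upper
  bound.\<close>

lemma lip_bound:
  assumes "edelstein_contraction J s" "y \<in> J" "y' \<in> J"
  shows "\<bar>s y - s y'\<bar> \<le> lip J s * \<bar>y - y'\<bar>"
proof (cases "y = y'")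
  case False
  let ?S = "{\<bar>s y - s y'\<bar> / \<bar>y - y'\<bar> | y y'. y \<in> J \<and> y' \<in> J \<and> y \<noteq> y'}"
  have "bdd_above ?S"
  proof (rule bdd_aboveI)
    fix z assume "z \<in> ?S"
    then show "z \<le> 1"
      using assms(1) by (auto simp: edelstein_contraction_def divide_le_eq_1 intro: less_imp_le)
  qed
  moreover have "\<bar>s y - s y'\<bar> / \<bar>y - y'\<bar> \<in> ?S" using assms False by blast
  ultimately have "\<bar>s y - s y'\<bar> / \<bar>y - y'\<bar> \<le> lip J s"
    unfolding lip_def by (rule cSup_upper[rotated])
  then show ?thesis using False by (simp add: divide_le_eq)
qed simp

text \<open>Two distinct points are required because the supremum of the empty set is
  unspecified.\<close>

lemma lip_nonneg:
  assumes "edelstein_contraction J s" "y \<in> J" "y' \<in> J" "y \<noteq> y'"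
  shows "0 \<le> lip J s"
  using order_trans[OF abs_ge_zero lip_bound[OF assms(1-3)]] assms(4)
  by (simp add: zero_le_mult_iff)

section \<open>Cover numbers and the upper box dimension\<close>

lemma cover_number_le:
  assumes "finite A" "F \<subseteq> (\<Union>a\<in>A. cbox a (a + \<delta> *\<^sub>R One))"
  shows "cover_number \<delta> F \<le> card A"
  unfolding cover_number_def by (rule Least_le) (intro exI[of _ A] conjI refl assms)

text \<open>After taking logarithms the constant contributes \<open>ln C / - ln \<delta>\<close>,
  which tends to 0.\<close>

lemma upper_box_dim_le:
  assumes C: "1 \<le> C" and N: "\<And>\<delta>. 0 < \<delta> \<Longrightarrow> \<delta> < 1 \<Longrightarrow> real (cover_number \<delta> F) \<le> C * (1 / \<delta>) powr d"
    and d: "0 \<le> d"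
  shows "upper_box_dim F \<le> ereal d"
proof -
  let ?b = "\<lambda>\<delta>::real. ln C / - ln \<delta> + d"
  have "ln (real (cover_number \<delta> F)) / - ln \<delta> \<le> ?b \<delta>" if \<delta>: "0 < \<delta>" "\<delta> < 1" for \<delta>
  proof -
    have pos: "0 < - ln \<delta>" using \<delta> by simp
    have "ln (real (cover_number \<delta> F)) \<le> ln C + d * - ln \<delta>"
    \<comment> \<open>In the zero case \<open>ln 0 = 0\<close>, so only nonnegativity of the right
      side is at stake, supplied by \<open>1 \<le> C\<close> and \<open>0 \<le> d\<close>.\<close>
    proof (cases "cover_number \<delta> F = 0")
      case True
      moreover have "0 \<le> ln C + d * - ln \<delta>"
        by (intro add_nonneg_nonneg mult_nonneg_nonneg ln_ge_zero C d less_imp_le[OF pos])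
      ultimately show ?thesis by simp
    next
      case False
      then have "ln (real (cover_number \<delta> F)) \<le> ln (C * (1 / \<delta>) powr d)"
        using N[OF \<delta>] by (intro ln_mono) simp_all
      also have "\<dots> = ln C + d * - ln \<delta>"
        using \<delta> C by (simp add: ln_mult ln_powr ln_div)
      finally show ?thesis .
    qed
    then have "ln (real (cover_number \<delta> F)) / - ln \<delta> \<le> (ln C + d * - ln \<delta>) / - ln \<delta>"
      using pos by (intro divide_right_mono) simp_all
    also have "\<dots> = ?b \<delta>" using pos by (simp add: add_divide_distrib diff_divide_distrib)
    finally show ?thesis .
  qed
  then have "eventually (\<lambda>\<delta>. ereal (ln (real (cover_number \<delta> F)) / - ln \<delta>) \<le> ereal (?b \<delta>)) (at_right 0)"
    unfolding eventually_at_right_field by (intro exI[of _ 1]) simp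
  then have "upper_box_dim F \<le> Limsup (at_right 0) (\<lambda>\<delta>. ereal (?b \<delta>))"
    unfolding upper_box_dim_def by (rule Limsup_mono)
  also have "\<dots> = ereal d"
  proof (rule lim_imp_Limsup)
    have "LIM \<delta> at_right 0. - ln \<delta> :> (at_top :: real filter)"
      using ln_at_0 by (simp add: filterlim_uminus_at_top)
    then have "((\<lambda>\<delta>::real. ln C / - ln \<delta>) \<longlongrightarrow> 0) (at_right 0)"
      by (intro tendsto_divide_0[OF tendsto_const] filterlim_at_top_imp_at_infinity)
    then have "(?b \<longlongrightarrow> 0 + d) (at_right 0)" by (intro tendsto_add tendsto_const)
    then show "((\<lambda>\<delta>. ereal (?b \<delta>)) \<longlongrightarrow> ereal d) (at_right 0)" by simp
  qed simp
  finally show ?thesis .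
qed

text \<open>The cell lies in a square of side at most \<delta> with lower left corner
  \<open>lw w 0\<close>, so one vertical column of cubes suffices. All values lie within
  \<open>M\<close> of the value at one vertex, hence the column height \<open>2 * M\<close>.\<close>

lemma graph_cell_cover:
  fixes f :: "plane \<Rightarrow> real"
  assumes w: "set w \<subseteq> {1,2,3}" and \<delta>: "0 < \<delta>" "1 / 2 ^ length w \<le> \<delta>" and M: "0 \<le> M"
    and osc: "\<And>x y. x \<in> gasket \<Longrightarrow> y \<in> gasket \<Longrightarrow> \<bar>f (lw w x) - f (lw w y)\<bar> \<le> M"
  shows "\<exists>A. finite A \<and> real (card A) \<le> 2 * M / \<delta> + 1 \<and>
    (\<lambda>x. (lw w x, f (lw w x))) ` gasket \<subseteq> (\<Union>a\<in>A. cbox a (a + \<delta> *\<^sub>R One))"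
proof -
  define c k where "c = f (lw w (q 1)) - M" and "k = nat \<lfloor>2 * M / \<delta>\<rfloor>"
  define A where "A = (\<lambda>i. (lw w 0, c + real i * \<delta>)) ` {..k}"
  have "card A \<le> Suc k" unfolding A_def using card_image_le[of "{..k}"] by simp
  moreover have "real k \<le> 2 * M / \<delta>" using M \<delta> by (simp add: k_def)
  ultimately have "real (card A) \<le> 2 * M / \<delta> + 1" by linarith
  moreover have "\<exists>a\<in>A. (lw w x, f (lw w x)) \<in> cbox a (a + \<delta> *\<^sub>R One)" if x: "x \<in> gasket" for x
  proof -
    define z where "z = (f (lw w x) - c) / \<delta>"
    define i where "i = nat \<lfloor>z\<rfloor>"
    have "\<bar>f (lw w x) - f (lw w (q 1))\<bar> \<le> M" by (rule osc[OF x q_gasket]) simp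
    then have "0 \<le> f (lw w x) - c" "f (lw w x) - c \<le> 2 * M" unfolding c_def by linarith+
    then have z: "0 \<le> z" "z \<le> 2 * M / \<delta>"
      unfolding z_def using \<delta>(1) by (auto intro: divide_right_mono)
    have "i \<le> k" unfolding i_def k_def using z by (intro nat_mono floor_mono)
    then have a: "(lw w 0, c + real i * \<delta>) \<in> A" unfolding A_def by (intro imageI) simp
    have "real i \<le> z" "z \<le> real i + 1" unfolding i_def using z by linarith+
    then have "real i * \<delta> \<le> z * \<delta>" "z * \<delta> \<le> (real i + 1) * \<delta>"
      using \<delta>(1) by (simp_all add: mult_right_mono)
    moreover have "z * \<delta> = f (lw w x) - c" using \<delta>(1) by (simp add: z_def)
    ultimately have f: "c + real i * \<delta> \<le> f (lw w x)" "f (lw w x) \<le> c + real i * \<delta> + \<delta>"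
      by (simp_all add: algebra_simps)
    let ?d = "1 / 2 ^ length w :: real"
    have "lw w x = lw w 0 + ?d *\<^sub>R x" using lw_diff[of w x 0] by (simp add: algebra_simps)
    then have eq: "fst (lw w x) = fst (lw w 0) + ?d * fst x" "snd (lw w x) = snd (lw w 0) + ?d * snd x"
      by simp_all
    have le: "0 \<le> ?d * t \<and> ?d * t \<le> \<delta>" if "0 \<le> t" "t \<le> 1" for t
    proof
      show "0 \<le> ?d * t" using that by simp
      have "?d * t \<le> ?d" by (rule mult_left_le) (use that in simp_all)
      then show "?d * t \<le> \<delta>" using \<delta>(2) by linarith
    qed
    have "fst (lw w 0) \<le> fst (lw w x)" "fst (lw w x) \<le> fst (lw w 0) + \<delta>"
      "snd (lw w 0) \<le> snd (lw w x)" "snd (lw w x) \<le> snd (lw w 0) + \<delta>"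
      using le[OF gasket_unit_square(1,2)[OF x]] le[OF gasket_unit_square(3,4)[OF x]] eq by linarith+
    then have "(lw w x, f (lw w x)) \<in> cbox (lw w 0, c + real i * \<delta>) ((lw w 0, c + real i * \<delta>) + \<delta> *\<^sub>R One)"
      using f by (simp add: mem_box Basis_prod_def ball_Un inner_add_left inner_prod_def)
    then show ?thesis using a by blast
  qed
  ultimately show ?thesis by (intro exI[of _ A]) (auto simp: A_def)
qed

lemma graph_cover:
  fixes f :: "plane \<Rightarrow> real"
  assumes \<delta>: "0 < \<delta>" "1 / 2 ^ m \<le> \<delta>" and M: "\<And>w. w \<in> words m \<Longrightarrow> 0 \<le> M w"
    and osc: "\<And>w x y. w \<in> words m \<Longrightarrow> x \<in> gasket \<Longrightarrow> y \<in> gasket \<Longrightarrow> \<bar>f (lw w x) - f (lw w y)\<bar> \<le> M w"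
  shows "real (cover_number \<delta> {(x, f x) | x. x \<in> gasket}) \<le> 2 / \<delta> * (\<Sum>w\<in>words m. M w) + 3 ^ m"
proof -
  have "\<exists>A. finite A \<and> real (card A) \<le> 2 * M w / \<delta> + 1 \<and>
    (\<lambda>x. (lw w x, f (lw w x))) ` gasket \<subseteq> (\<Union>a\<in>A. cbox a (a + \<delta> *\<^sub>R One))" if w: "w \<in> words m" for w
  proof (rule graph_cell_cover)
    show "set w \<subseteq> {1,2,3}" "1 / 2 ^ length w \<le> \<delta>" using w \<delta>(2) by (simp_all add: words_def)
  qed (rule \<delta>(1) M[OF w] osc[OF w]; assumption)+
  then obtain A where "\<forall>w\<in>words m. finite (A w) \<and> real (card (A w)) \<le> 2 * M w / \<delta> + 1 \<and>
      (\<lambda>x. (lw w x, f (lw w x))) ` gasket \<subseteq> (\<Union>a\<in>A w. cbox a (a + \<delta> *\<^sub>R One))"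
    using bchoice[of "words m"] by meson
  then have A: "finite (A w)" "real (card (A w)) \<le> 2 * M w / \<delta> + 1"
    "(\<lambda>x. (lw w x, f (lw w x))) ` gasket \<subseteq> (\<Union>a\<in>A w. cbox a (a + \<delta> *\<^sub>R One))"
    if "w \<in> words m" for w
    using that by blast+
  let ?A = "\<Union>w\<in>words m. A w"
  have "{(x, f x) | x. x \<in> gasket} \<subseteq> (\<Union>a\<in>?A. cbox a (a + \<delta> *\<^sub>R One))"
  proof
    fix p assume "p \<in> {(x, f x) | x. x \<in> gasket}"
    then obtain x where x: "x \<in> gasket" "p = (x, f x)" by blast
    obtain w y where w: "w \<in> words m" "y \<in> gasket" "x = lw w y" using gasket_in_cell[OF x(1)] by blast
    then have "p \<in> (\<lambda>x. (lw w x, f (lw w x))) ` gasket" by (simp add: x)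
    then show "p \<in> (\<Union>a\<in>?A. cbox a (a + \<delta> *\<^sub>R One))" using A(3)[OF w(1)] w(1) by blast
  qed
  then have "cover_number \<delta> {(x, f x) | x. x \<in> gasket} \<le> card ?A"
    by (intro cover_number_le) (auto simp: finite_words A(1))
  also have "card ?A \<le> (\<Sum>w\<in>words m. card (A w))" by (rule card_UN_le[OF finite_words])
  finally have "real (cover_number \<delta> {(x, f x) | x. x \<in> gasket}) \<le> (\<Sum>w\<in>words m. real (card (A w)))"
    by (simp flip: of_nat_sum)
  also have "\<dots> \<le> (\<Sum>w\<in>words m. 2 * M w / \<delta> + 1)" by (intro sum_mono A(2))
  also have "\<dots> = 2 / \<delta> * (\<Sum>w\<in>words m. M w) + 3 ^ m"
    by (simp add: sum.distrib card_words sum_distrib_left)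
  finally show ?thesis .
qed

section \<open>Oscillation of the interpolation function\<close>

text \<open>The recursion mirrors the functional equation: \<open>L n\<close> contracts the
  oscillation on the cell \<open>w\<close>, and the last term bounds that of \<open>h n\<close>
  there. The base \<open>B\<close> bounds the oscillation on the whole gasket.\<close>

primrec osc_bound :: "(nat \<Rightarrow> real) \<Rightarrow> real \<Rightarrow> real \<Rightarrow> nat list \<Rightarrow> real" where
  "osc_bound L B D [] = B"
| "osc_bound L B D (n # w) = L n * osc_bound L B D w + D * (3/5) ^ length w"

lemma osc_bound_nonneg:
  assumes "\<And>n. n \<in> {1,2,3} \<Longrightarrow> 0 \<le> L n" "0 \<le> B" "0 \<le> D" "set w \<subseteq> {1,2,3}"
  shows "0 \<le> osc_bound L B D w"
  using assms(4) by (induction w) (simp_all add: assms(1-3) del: insert_iff)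

text \<open>The sums obey a recursion with factor \<kappa> and an inhomogeneous term
  \<open>3 * D * (9/5) ^ m\<close>. The gap between \<kappa> and \<rho> absorbs this term; the
  constant is chosen so that \<open>\<kappa> * C + 3 * D \<le> \<rho> * C\<close>.\<close>

lemma sum_osc_bound_le:
  assumes L: "\<And>n. n \<in> {1,2,3} \<Longrightarrow> 0 \<le> L n" and B: "0 \<le> B" and D: "0 \<le> D"
    and \<rho>: "(\<Sum>n\<in>{1,2,3}. L n) \<le> \<kappa>" "9/5 \<le> \<kappa>" "\<kappa> < \<rho>"
  shows "(\<Sum>w\<in>words m. osc_bound L B D w) \<le> (B + 3 * D / (\<rho> - \<kappa>)) * \<rho> ^ m"
proof (induction m)
  case 0
  show ?case using D \<rho> by (simp add: words_0)
next
  case (Suc m)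
  define C where "C = B + 3 * D / (\<rho> - \<kappa>)"
  let ?S = "\<Sum>w\<in>words m. osc_bound L B D w"
  have S0: "0 \<le> ?S"
    by (rule sum_nonneg) (use osc_bound_nonneg[OF L B D] in \<open>auto simp: words_def\<close>)
  have "(\<Sum>w\<in>words (Suc m). osc_bound L B D w)
      = (\<Sum>n\<in>{1,2,3}. L n * ?S + 3 ^ m * (D * (3/5) ^ m))"
    unfolding sum_words_Suc
  proof (rule sum.cong[OF refl])
    fix n
    have "(\<Sum>w\<in>words m. osc_bound L B D (n # w)) = L n * ?S + (\<Sum>w\<in>words m. D * (3/5) ^ length w)"
      by (simp add: sum.distrib sum_distrib_left)
    also have "(\<Sum>w\<in>words m. D * (3/5) ^ length w) = (\<Sum>w\<in>words m. D * (3/5) ^ m)"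
      by (rule sum.cong) (auto simp: words_def)
    finally show "(\<Sum>w\<in>words m. osc_bound L B D (n # w)) = L n * ?S + 3 ^ m * (D * (3/5) ^ m)"
      by (simp add: card_words)
  qed
  also have "\<dots> = (\<Sum>n\<in>{1,2,3}. L n) * ?S + 3 * (3 ^ m * (D * (3/5) ^ m))"
    by (simp add: algebra_simps)
  \<comment> \<open>This is the origin of the threshold 9/5: three times as many cells per level,
    each with harmonic oscillation reduced by 3/5.\<close>
  also have "3 ^ m * (D * (3/5) ^ m) = D * (9/5) ^ m"
    by (simp flip: power_mult_distrib)
  also have "(\<Sum>n\<in>{1,2,3}. L n) * ?S + 3 * (D * (9/5) ^ m) \<le> \<kappa> * (C * \<rho> ^ m) + 3 * (D * \<rho> ^ m)"
  proof (intro add_mono mult_mono)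
    show "?S \<le> C * \<rho> ^ m" using Suc.IH by (simp add: C_def)
    show "(9/5) ^ m \<le> \<rho> ^ m" using \<rho> by (intro power_mono) simp_all
  qed (use \<rho> D S0 in simp_all)
  also have "\<dots> = (\<kappa> * C + 3 * D) * \<rho> ^ m" by (simp add: algebra_simps)
  also have "\<dots> \<le> (\<rho> * C) * \<rho> ^ m"
  proof (rule mult_right_mono)
    have "(\<rho> - \<kappa>) * C = (\<rho> - \<kappa>) * B + 3 * D" using \<rho> by (simp add: C_def distrib_left)
    moreover have "0 \<le> (\<rho> - \<kappa>) * B" using \<rho> B by simp
    ultimately show "\<kappa> * C + 3 * D \<le> \<rho> * C" by (simp add: algebra_simps)
  qed (use \<rho> in simp)
  finally show ?case by (simp add: C_def algebra_simps)
qed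

section \<open>Dimension bounds from the oscillation sums\<close>

lemma graph_upper_box_dim_le_strict:
  fixes f :: "plane \<Rightarrow> real"
  assumes L: "\<And>n. n \<in> {1,2,3} \<Longrightarrow> 0 \<le> L n" and B: "0 \<le> B" and D: "0 \<le> D"
    and \<rho>: "(\<Sum>n\<in>{1,2,3}. L n) \<le> \<kappa>" "9/5 \<le> \<kappa>" "\<kappa> < \<rho>"
    and osc: "\<And>w x y. set w \<subseteq> {1,2,3} \<Longrightarrow> x \<in> gasket \<Longrightarrow> y \<in> gasket \<Longrightarrow>
      \<bar>f (lw w x) - f (lw w y)\<bar> \<le> osc_bound L B D w"
  shows "upper_box_dim {(x, f x) | x. x \<in> gasket} \<le> ereal (1 + ln \<rho> / ln 2)"
proof -
  \<comment> \<open>The exponent is chosen so that \<open>2 powr d = 2 * \<rho>\<close>, the growth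
    rate per level of the number of cubes.\<close>
  define C d where "C = B + 3 * D / (\<rho> - \<kappa>)" and "d = 1 + ln \<rho> / ln 2"
  have C: "0 \<le> C" using B D \<rho> by (simp add: C_def)
  have "0 \<le> ln \<rho>" using \<rho> by simp
  then have d: "0 \<le> d" by (simp add: d_def)
  have two_d: "2 powr d = 2 * \<rho>"
  proof -
    have "2 powr d = exp (ln 2 + ln \<rho>)" by (simp add: d_def powr_def algebra_simps)
    also have "\<dots> = 2 * \<rho>" using \<rho> by (simp add: exp_add)
    finally show ?thesis .
  qed
  have "real (cover_number \<delta> {(x, f x) | x. x \<in> gasket}) \<le> ((4 * C + 1) * 2 powr d) * (1 / \<delta>) powr d"
    if \<delta>: "0 < \<delta>" "\<delta> < 1" for \<delta>
  proof -
    \<comment> \<open>The coarsest level whose cells have side at most \<delta>; thus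
      \<open>2 ^ m\<close> lies between \<open>1 / \<delta>\<close> and
      \<open>2 / \<delta>\<close>.\<close>
    define m where "m = nat \<lceil>log 2 (1 / \<delta>)\<rceil>"
    have "0 \<le> log 2 (1 / \<delta>)" using \<delta> by simp
    then have m: "log 2 (1 / \<delta>) \<le> real m" "real m \<le> log 2 (1 / \<delta>) + 1"
      unfolding m_def by linarith+
    have "1 / \<delta> \<le> 2 powr real m" "2 powr real m \<le> 2 powr (log 2 (1 / \<delta>) + 1)"
      using m \<delta> by (simp_all add: log_le_iff)
    then have pm: "1 / \<delta> \<le> 2 ^ m" "2 ^ m \<le> 2 / \<delta>"
      using \<delta> by (simp_all add: powr_realpow powr_add)
    then have "1 / 2 ^ m \<le> \<delta>" using \<delta> by (simp add: field_simps)
    then have "real (cover_number \<delta> {(x, f x) | x. x \<in> gasket})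
        \<le> 2 / \<delta> * (\<Sum>w\<in>words m. osc_bound L B D w) + 3 ^ m"
      using \<delta> osc osc_bound_nonneg[OF L B D]
      by (intro graph_cover) (auto simp: words_def)
    also have "\<dots> \<le> 2 * 2 ^ m * (C * \<rho> ^ m) + (2 * \<rho>) ^ m"
    proof (intro add_mono mult_mono)
      show "2 / \<delta> \<le> 2 * 2 ^ m" using pm(1) by simp
      show "(\<Sum>w\<in>words m. osc_bound L B D w) \<le> C * \<rho> ^ m"
        unfolding C_def by (rule sum_osc_bound_le[OF L B D \<rho>])
      \<comment> \<open>The one extra cube per cell costs no more than the main term, since \<rho>
        exceeds 9/5 and so 3/2.\<close>
      show "3 ^ m \<le> (2 * \<rho>) ^ m" using \<rho> by (intro power_mono) simp_all
      show "0 \<le> (\<Sum>w\<in>words m. osc_bound L B D w)"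
        by (rule sum_nonneg) (use osc_bound_nonneg[OF L B D] in \<open>auto simp: words_def\<close>)
    qed simp
    also have "\<dots> = (2 * C + 1) * (2 * \<rho>) ^ m" by (simp add: power_mult_distrib algebra_simps)
    also have "\<dots> \<le> (4 * C + 1) * (2 * \<rho>) ^ m" using C \<rho> by (intro mult_right_mono) simp_all
    also have "(2 * \<rho>) ^ m = (2 ^ m) powr d"
    proof -
      have "(2 ^ m) powr d = (2 powr real m) powr d" by (simp add: powr_realpow)
      also have "\<dots> = (2 powr d) powr real m" by (simp add: powr_powr mult.commute)
      finally show ?thesis using \<rho> by (simp add: two_d powr_realpow)
    qed
    also have "(4 * C + 1) * (2 ^ m) powr d \<le> (4 * C + 1) * (2 / \<delta>) powr d"
      using C pm(2) d by (intro mult_left_mono powr_mono2) simp_all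
    also have "(2 / \<delta>) powr d = 2 powr d * (1 / \<delta>) powr d"
      using powr_mult[of 2 "1 / \<delta>" d] \<delta> by simp
    finally show ?thesis by (simp add: mult.assoc)
  qed
  moreover have "1 \<le> (4 * C + 1) * 2 powr d"
    using C \<rho> mult_mono[of 1 "4 * C + 1" 1 "2 * \<rho>"] by (simp add: two_d)
  ultimately show ?thesis using upper_box_dim_le[OF _ _ d] unfolding d_def by blast
qed

lemma graph_upper_box_dim_le:
  fixes f :: "plane \<Rightarrow> real"
  assumes L: "\<And>n. n \<in> {1,2,3} \<Longrightarrow> 0 \<le> L n" and B: "0 \<le> B" and D: "0 \<le> D"
    and \<kappa>: "(\<Sum>n\<in>{1,2,3}. L n) \<le> \<kappa>" "9/5 \<le> \<kappa>"
    and osc: "\<And>w x y. set w \<subseteq> {1,2,3} \<Longrightarrow> x \<in> gasket \<Longrightarrow> y \<in> gasket \<Longrightarrow>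
      \<bar>f (lw w x) - f (lw w y)\<bar> \<le> osc_bound L B D w"
  shows "upper_box_dim {(x, f x) | x. x \<in> gasket} \<le> ereal (1 + ln \<kappa> / ln 2)"
proof (rule ereal_le_epsilon2)
  fix e :: real assume e: "0 < e"
  \<comment> \<open>Multiplying \<kappa> by 2 to the power \<open>e\<close> raises the resulting
    dimension bound by exactly \<open>e\<close>.\<close>
  define \<rho> where "\<rho> = \<kappa> * exp (e * ln 2)"
  have "\<kappa> * 1 < \<rho>" unfolding \<rho>_def using e \<kappa>(2) by (intro mult_strict_left_mono) simp_all
  then have \<rho>: "\<kappa> < \<rho>" by simp
  have "upper_box_dim {(x, f x) | x. x \<in> gasket} \<le> ereal (1 + ln \<rho> / ln 2)"
    by (rule graph_upper_box_dim_le_strict[OF L B D \<kappa> \<rho> osc])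
  also have "ln \<rho> = ln \<kappa> + e * ln 2" using \<kappa>(2) by (simp add: \<rho>_def ln_mult)
  finally show "upper_box_dim {(x, f x) | x. x \<in> gasket} \<le> ereal (1 + ln \<kappa> / ln 2) + ereal e"
    by (simp add: add_divide_distrib add.assoc)
qed

section \<open>The graph of the interpolation function\<close>

theorem theorem4p1:
  fixes J :: "real set"
    and u :: "plane \<Rightarrow> real"
    and h :: "nat \<Rightarrow> plane \<Rightarrow> real"
    and s :: "nat \<Rightarrow> real \<Rightarrow> real"
    and f :: "plane \<Rightarrow> real"
    and G :: "(plane \<times> real) set"
    and \<mu> :: real
  assumes "compact J"
    and "u ` V 1 \<subseteq> J"
    and "\<And>n. n \<in> {1,2,3} \<Longrightarrow> harmonic (h n)"
    and "\<And>n. n \<in> {1,2,3} \<Longrightarrow> \<not> h n constant_on gasket"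
    and "\<And>n. n \<in> {1,2,3} \<Longrightarrow> edelstein_contraction J (s n)"
    and "\<And>n x y. n \<in> {1,2,3} \<Longrightarrow> x \<in> gasket \<Longrightarrow> y \<in> J \<Longrightarrow> h n x + s n y \<in> J"
    and "\<And>n k. n \<in> {1,2,3} \<Longrightarrow> k \<in> {1,2,3} \<Longrightarrow> h n (q k) + s n (u (q k)) = u (l n (q k))"
    and "continuous_on gasket f"
    and "f ` gasket \<subseteq> J"
    and "\<And>t. t \<in> V 1 \<Longrightarrow> f t = u t"
    and "\<And>n x. n \<in> {1,2,3} \<Longrightarrow> x \<in> gasket \<Longrightarrow> f (l n x) = s n (f x) + h n x"
    and "G = {(x, f x) | x. x \<in> gasket}"
    and "\<not> coplanar {(t, u t) | t. t \<in> V 1}"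
    and "\<mu> = (\<Sum>n\<in>{1,2,3}. lip J (s n))"
  shows "(\<mu> > 9/5 \<longrightarrow>
            upper_box_dim G \<le> ereal (1 + ln \<mu> / ln 2) \<and>
            (\<forall>d. has_box_dim G d \<longrightarrow> d \<le> ereal (1 + ln \<mu> / ln 2))) \<and>
         (\<mu> \<le> 9/5 \<longrightarrow>
            upper_box_dim G \<le> ereal (ln (18/5) / ln 2) \<and>
            (\<forall>d. has_box_dim G d \<longrightarrow> d \<le> ereal (ln (18/5) / ln 2)))"
proof -
  note harm = assms(3) and nonconst = assms(4) and edel = assms(5) and range = assms(6)
    and cont = assms(8) and fJ = assms(9) and fixp = assms(11) and G = assms(12) and \<mu> = assms(14)
  let ?L = "\<lambda>n. lip J (s n)"
  have one: "(1::nat) \<in> {1,2,3}" by simp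
  obtain y where y: "y \<in> J" using fJ q_gasket[OF one] by blast
  \<comment> \<open>Nonconstancy of \<open>h 1\<close> yields two distinct points
    \<open>h 1 a + s 1 y\<close> and \<open>h 1 b + s 1 y\<close> of \<open>J\<close>, which makes
    \<open>lip J\<close> meaningful.\<close>
  obtain a b where ab: "a \<in> gasket" "b \<in> gasket" "h 1 a \<noteq> h 1 b"
    using nonconst[OF one] unfolding constant_on_def by metis
  have L: "0 \<le> ?L n" if "n \<in> {1,2,3}" for n
    using lip_nonneg[OF edel[OF that] range[OF one ab(1) y] range[OF one ab(2) y]] ab(3) by simp
  have "\<exists>D. 0 \<le> D \<and> (\<forall>w x y. set w \<subseteq> {1,2,3} \<longrightarrow> x \<in> gasket \<longrightarrow> y \<in> gasket \<longrightarrow>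
      \<bar>h n (lw w x) - h n (lw w y)\<bar> \<le> D * (3/5) ^ length w)" if "n \<in> {1,2,3}" for n
    using harmonic_decay[OF harm[OF that]] by metis
  then obtain D where D: "\<And>n. n \<in> {1,2,3} \<Longrightarrow> 0 \<le> D n"
    "\<And>n w x y. n \<in> {1,2,3} \<Longrightarrow> set w \<subseteq> {1,2,3} \<Longrightarrow> x \<in> gasket \<Longrightarrow> y \<in> gasket \<Longrightarrow>
      \<bar>h n (lw w x) - h n (lw w y)\<bar> \<le> D n * (3/5) ^ length w"
    by metis
  \<comment> \<open>A single decay constant valid for all three harmonic functions.\<close>
  define E where "E = (\<Sum>n\<in>{1,2,3}. D n)"
  have E: "0 \<le> E" unfolding E_def by (intro sum_nonneg D(1))
  have DE: "D n \<le> E" if "n \<in> {1,2,3}" for n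
    unfolding E_def by (rule member_le_sum[OF that]) (use D(1) in auto)
  have "bounded (f ` gasket)"
    by (intro compact_imp_bounded compact_continuous_image cont gasket_props(1))
  then obtain M where M: "\<And>x. x \<in> gasket \<Longrightarrow> \<bar>f x\<bar> \<le> M"
    unfolding bounded_iff by auto
  have M0: "0 \<le> 2 * M" using M[OF ab(1)] by linarith
  \<comment> \<open>Induction along the word from the outermost letter, using the functional
    equation at points of the cell \<open>w\<close>.\<close>
  have osc: "\<bar>f (lw w x) - f (lw w y)\<bar> \<le> osc_bound ?L (2 * M) E w"
    if "set w \<subseteq> {1,2,3}" "x \<in> gasket" "y \<in> gasket" for w x y
    using that(1)
  proof (induction w)
    case Nil
    show ?case using M[OF that(2)] M[OF that(3)] by simp
  next
    case (Cons n w)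
    then have n: "n \<in> {1,2,3}" and w: "set w \<subseteq> {1,2,3}" by auto
    let ?x = "lw w x" and ?y = "lw w y"
    have K: "?x \<in> gasket" "?y \<in> gasket" using lw_gasket[OF w] that by blast+
    have "\<bar>s n (f ?x) - s n (f ?y)\<bar> \<le> ?L n * \<bar>f ?x - f ?y\<bar>"
      using K fJ by (intro lip_bound[OF edel[OF n]]) blast+
    also have "\<dots> \<le> ?L n * osc_bound ?L (2 * M) E w"
      by (rule mult_left_mono[OF Cons.IH[OF w] L[OF n]])
    finally have "\<bar>s n (f ?x) - s n (f ?y)\<bar> \<le> ?L n * osc_bound ?L (2 * M) E w" .
    moreover have "\<bar>h n ?x - h n ?y\<bar> \<le> E * (3/5) ^ length w"
      by (rule order_trans[OF D(2)[OF n w that(2,3)]]) (intro mult_right_mono DE n; simp)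
    ultimately show ?case by (simp add: fixp[OF n K(1)] fixp[OF n K(2)])
  qed
  have bound: "upper_box_dim G \<le> ereal (1 + ln \<kappa> / ln 2)" if "\<mu> \<le> \<kappa>" "9/5 \<le> \<kappa>" for \<kappa>
    unfolding G by (rule graph_upper_box_dim_le[OF L M0 E that(1)[unfolded \<mu>] that(2) osc])
  \<comment> \<open>The two cases use \<kappa> = \<mu> and \<kappa> = 9/5; in the second, the
    summand 1 turns 9/5 into 18/5. A box-counting dimension, if it exists, equals the upper one and
    inherits the bound.\<close>
  have "1 + ln (9/5) / ln 2 = ln (18/5) / ln (2::real)"
    using ln_mult[of 2 "9/5::real"] by (simp add: field_simps)
  then show ?thesis
    using bound[of \<mu>] bound[of "9/5"] unfolding has_box_dim_def by auto
qed

end
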